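(* Let $\gamma\in[0,1]$, $\alpha>0$, $A\in\mathbb{R}^{M\times N}$, $Y\in\mathbb{R}^{M\times K}$, and let $\bar Z\in\mathbb{R}^{N\times K}$ be a local minimum of $J_\gamma(Z)=\Psi_\gamma(Z)+\frac1{2\alpha}\|AZ-Y\|_{\mathrm{Fro}}^2$, where either $\gamma>0$ or $\bar Z^T\bar Z$ is invertible. Let $\bar z_n$ be the $n$-th row of $\bar Z$ (as a $1\times K$ vector) and $\bar W=(\gamma I+(1-\gamma)\bar Z^T\bar Z)^{-1}$. Then $$\bar z_n\Big(\frac1{\|\bar z_n\|_{\bar W}}\bar W-\sum_{i=1}^N\frac{1-\gamma}{\|\bar z_i\|_{\bar W}}\bar W\bar z_i^T\bar z_i\bar W\Big)+\frac1\alpha\big(A^T(A\bar Z-Y)\big)_n=0\quad\text{for all }n\text{ with }\bar z_n\ne0,$$ $$\big\|\big(A^T(A\bar Z-Y)\big)_n\bar W^{-1}\big\|_{\bar W}=\big\|\big(A^T(A\bar Z-Y)\big)_n\big\|_{\bar W^{-1}}\le\alpha\quad\text{for all }n\text{ with }\bar z_n=0,$$ where terms of the sum with $\bar z_i=0$ are read as zero.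
   Context: $\Psi_\gamma(Z)=\|Z(\gamma I+(1-\gamma)Z^TZ)^{\dagger/2}\|_{2,1}$, where $\|\cdot\|_{2,1}$ is the sum of the Euclidean norms of the rows and $(\cdot)^{\dagger/2}$ is the square root of the Moore–Penrose pseudo-inverse of a symmetric nonnegative matrix. $\|\cdot\|_{\mathrm{Fro}}$ is the Frobenius norm, $(\cdot)_n$ denotes the $n$-th row, and $\|z\|_W=\sqrt{zWz^T}$ for a row vector $z\in\mathbb{R}^{1\times K}$ and symmetric positive definite $W$. *)

theory Defs
  imports "HOL-Analysis.Analysis"
begin

text \<open>An \<open>N\<close> by \<open>K\<close> real matrix is an element of \<open>real^'k^'n\<close>. The library norm on that type is
  the Frobenius norm, and it also induces the topology used for local minima.\<close>

lemma norm_matrix_Frobenius: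
  fixes B :: "real^'k^'n"
  shows "norm B = sqrt (\<Sum>i\<in>UNIV. \<Sum>j\<in>UNIV. (B $ i $ j)\<^sup>2)"
  by (simp add: norm_vec_def L2_set_def sum_nonneg)

definition norm_2_1 :: "real^'k^'n \<Rightarrow> real" where
  "norm_2_1 B = (\<Sum>i\<in>UNIV. norm (row i B))"

definition is_pseudo_inverse :: "real^'k^'n \<Rightarrow> real^'n^'k \<Rightarrow> bool" where
  "is_pseudo_inverse B X \<longleftrightarrow>
     B ** X ** B = B \<and> X ** B ** X = X \<and>
     transpose (B ** X) = B ** X \<and> transpose (X ** B) = X ** B"

definition pseudo_inverse :: "real^'k^'n \<Rightarrow> real^'n^'k" where
  "pseudo_inverse B = (THE X. is_pseudo_inverse B X)"

definition sym_nonneg :: "real^'k^'k \<Rightarrow> bool" where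
  "sym_nonneg S \<longleftrightarrow> transpose S = S \<and> (\<forall>x. 0 \<le> x \<bullet> (S *v x))"

text \<open>Only meaningful for symmetric nonnegative arguments.\<close>

definition matrix_sqrt :: "real^'k^'k \<Rightarrow> real^'k^'k" where
  "matrix_sqrt S = (THE R. sym_nonneg R \<and> R ** R = S)"

definition Psi :: "real \<Rightarrow> real^'k^'n \<Rightarrow> real" where
  "Psi \<gamma> Z = norm_2_1 (Z ** matrix_sqrt (pseudo_inverse
     (\<gamma> *\<^sub>R mat 1 + (1 - \<gamma>) *\<^sub>R (transpose Z ** Z))))"

definition J :: "real \<Rightarrow> real \<Rightarrow> real^'n^'m \<Rightarrow> real^'k^'m \<Rightarrow> real^'k^'n \<Rightarrow> real" where
  "J \<gamma> \<alpha> A Y Z = Psi \<gamma> Z + 1 / (2 * \<alpha>) * (norm (A ** Z - Y))\<^sup>2"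

definition local_minimum :: "('a::topological_space \<Rightarrow> real) \<Rightarrow> 'a \<Rightarrow> bool" where
  "local_minimum f x \<longleftrightarrow> (\<forall>\<^sub>F y in nhds x. f x \<le> f y)"

text \<open>Row vectors are elements of \<open>real^'k\<close>: \<open>z v* W\<close> is the product \<open>z W\<close>, and \<open>outer x y\<close>
  is the matrix \<open>x\<^sup>T y\<close>.\<close>

definition weighted_norm :: "real^'k^'k \<Rightarrow> real^'k \<Rightarrow> real" where
  "weighted_norm W z = sqrt ((z v* W) \<bullet> z)"

definition outer :: "real^'k \<Rightarrow> real^'l \<Rightarrow> real^'l^'k" where
  "outer x y = (\<chi> i j. x $ i * y $ j)"

end

theory Submission
  imports Defs
begin

text \<open>Since \<open>S(Z) = \<gamma> I + (1 - \<gamma>) Z\<^sup>T Z\<close> is positive definite near the minimum, there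
  \<open>\<Psi>\<^sub>\<gamma>(Z)\<close> is the sum of the norms of the rows \<open>z\<^sub>i\<close> weighted by \<open>W = S(Z)\<^sup>-\<^sup>1\<close>. It has a one-sided
  derivative in every direction: a nonzero row contributes smoothly, a zero row contributes the
  weighted norm of its increment. At a local minimum the one-sided derivative of \<open>J\<close> is
  nonnegative. Perturbing only row \<open>n\<close>, by \<open>v\<close>: if \<open>z\<^sub>n \<noteq> 0\<close> the derivative is linear in \<open>v\<close>, so
  the gradient vanishes; if \<open>z\<^sub>n = 0\<close> it is \<open>\<parallel>v\<parallel>\<^sub>W + \<langle>g\<^sub>n, v\<rangle> / \<alpha>\<close>, with \<open>g\<^sub>n\<close> the
  \<open>n\<close>-th row of \<open>A\<^sup>T (A Z - Y)\<close>, and \<open>v = - g\<^sub>n W\<^sup>-\<^sup>1\<close> gives the bound.\<close>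

section \<open>Spectral theorem and matrix square roots\<close>

text \<open>For small \<open>t\<close> the linear term dominates, so it must vanish. This is the
  first-order condition at a maximum.\<close>

lemma linear_coeff_zero_if_quadratic_nonpos:
  fixes a b :: real
  assumes "\<And>t. 2 * t * a + t\<^sup>2 * b \<le> 0"
  shows "a = 0"
proof (rule ccontr)
  assume a: "a \<noteq> 0"
  \<comment> \<open>At \<open>t = a / d\<close> the quadratic equals
    \<open>t^2 * (2 * d + b)\<close>; this \<open>d\<close> makes the second factor
    positive.\<close>
  define d where "d = 1 + \<bar>b\<bar>"
  have d: "d > 0"
    by (simp add: d_def)
  then have "2 * (a / d) * a + (a / d)\<^sup>2 * b = (a / d)\<^sup>2 * (2 * d + b)"
    by (simp add: power2_eq_square field_simps)
  moreover have "2 * d + b > 0"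
    by (simp add: d_def)
  ultimately show False
    using assms[of "a / d"] a d by (smt (verit) divide_eq_0_iff mult_pos_pos zero_less_power2)
qed

text \<open>A maximizer \<open>v\<close> of the Rayleigh quotient on the unit sphere of
  \<open>V\<close> is an eigenvector: the first variation makes \<open>f v\<close> orthogonal to
  every \<open>w\<close> in \<open>V\<close> that is orthogonal to \<open>v\<close>, and the
  residual \<open>f v - c *\<^sub>R v\<close> is itself such a \<open>w\<close>.\<close>

lemma selfadjoint_eigenvector_subspace:
  fixes f :: "'a::euclidean_space \<Rightarrow> 'a"
  assumes lin: "linear f" and sa: "\<And>x y. f x \<bullet> y = x \<bullet> f y"
    and V: "subspace V" and inv: "f ` V \<subseteq> V" and ne: "V \<noteq> {0}"
  obtains v c where "v \<in> V" "norm v = 1" "f v = c *\<^sub>R v"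
proof -
  let ?K = "V \<inter> sphere 0 1"
  obtain u where u: "u \<in> V" "u \<noteq> 0"
    using ne V subspace_0 by blast
  have "u /\<^sub>R norm u \<in> ?K"
    using u V by (simp add: subspace_scale)
  moreover have "compact ?K"
    by (simp add: V closed_Int_compact closed_subspace)
  moreover have "continuous_on ?K (\<lambda>x. x \<bullet> f x)"
    by (intro continuous_intros linear_continuous_on_compose[OF _ lin])
  ultimately obtain v where v: "v \<in> ?K" and vmax: "\<And>y. y \<in> ?K \<Longrightarrow> y \<bullet> f y \<le> v \<bullet> f v"
    using continuous_attains_sup[of ?K "\<lambda>x. x \<bullet> f x"] by blast
  define c where "c = v \<bullet> f v"
  have vV: "v \<in> V" and nv: "norm v = 1"
    using v by auto
  have le: "y \<bullet> f y \<le> c * (y \<bullet> y)" if "y \<in> V" for y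
  proof (cases "y = 0")
    case False
    have "(y /\<^sub>R norm y) \<bullet> f (y /\<^sub>R norm y) \<le> c"
      unfolding c_def by (rule vmax) (use that False V in \<open>simp add: subspace_scale\<close>)
    then show ?thesis
      using False by (simp add: linear_cmul[OF lin] divide_simps power2_eq_square dot_square_norm)
  qed (simp add: linear_0[OF lin])
  have perp: "w \<bullet> f v = 0" if w: "w \<in> V" "w \<bullet> v = 0" for w
  proof -
    let ?a = "w \<bullet> f v" and ?b = "w \<bullet> f w - c * (w \<bullet> w)"
    \<comment> \<open>Insert \<open>v + t *\<^sub>R w\<close> into \<open>le\<close>: the constant
      terms cancel and \<open>v \<bullet> w = 0\<close> removes the linear term on the
      right.\<close>
    have quad: "2 * t * ?a + t\<^sup>2 * ?b \<le> 0" for t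
    proof -
      have "(v + t *\<^sub>R w) \<bullet> f (v + t *\<^sub>R w) \<le> c * ((v + t *\<^sub>R w) \<bullet> (v + t *\<^sub>R w))"
        using w vV V by (intro le) (simp add: subspace_add subspace_scale)
      moreover have "v \<bullet> f w = w \<bullet> f v"
        by (metis inner_commute sa)
      moreover have "v \<bullet> v = 1"
        using nv by (simp add: dot_square_norm)
      moreover have "v \<bullet> w = 0"
        using w by (simp add: inner_commute)
      ultimately show ?thesis
        using w by (simp add: linear_add[OF lin] linear_cmul[OF lin] inner_simps c_def[symmetric]
            algebra_simps power2_eq_square)
    qed
    show ?thesis
      using quad by (rule linear_coeff_zero_if_quadratic_nonpos)
  qed
  have "f v \<in> V"
    using inv vV by blast
  then have "f v - c *\<^sub>R v \<in> V"
    using vV V by (simp add: subspace_diff subspace_scale)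
  moreover have "(f v - c *\<^sub>R v) \<bullet> v = 0"
    using nv by (simp add: inner_simps c_def dot_square_norm inner_commute)
  ultimately have "(f v - c *\<^sub>R v) \<bullet> (f v - c *\<^sub>R v) = 0"
    using perp[of "f v - c *\<^sub>R v"] by (simp add: inner_diff_right)
  then show thesis
    using that[of v c] vV nv by simp
qed

text \<open>Take an orthonormal set of eigenvectors of maximal cardinality. If it did not span, its
  orthogonal complement would be a nonzero invariant subspace, and a unit eigenvector in it would
  enlarge the set.\<close>

theorem selfadjoint_eigenbasis:
  fixes f :: "'a::euclidean_space \<Rightarrow> 'a"
  assumes lin: "linear f" and sa: "\<And>x y. f x \<bullet> y = x \<bullet> f y"
  obtains B where "finite B" "pairwise orthogonal B" "\<And>b. b \<in> B \<Longrightarrow> norm b = 1"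
    "span B = UNIV" "\<And>b. b \<in> B \<Longrightarrow> \<exists>c. f b = c *\<^sub>R b"
proof -
  define P where "P B \<longleftrightarrow> pairwise orthogonal B \<and> (\<forall>b\<in>B. norm b = 1 \<and> (\<exists>c. f b = c *\<^sub>R b))"
    for B :: "'a set"
  have indep: "independent B" if "P B" for B
    using that by (intro pairwise_orthogonal_independent) (auto simp: P_def)
  have "P {}"
    by (simp add: P_def)
  moreover have "\<forall>B. P B \<longrightarrow> card B < Suc DIM('a)"
    using indep independent_bound le_imp_less_Suc by metis
  ultimately obtain B where B: "P B" and max: "\<And>C. P C \<Longrightarrow> card C \<le> card B"
    using ex_has_greatest_nat[of P "{}" card] by blast
  have fin: "finite B"
    using indep[OF B] independent_imp_finite by blast
  have "span B = UNIV"
  proof (rule ccontr)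
    assume "span B \<noteq> UNIV"
    then obtain u where u: "u \<noteq> 0" "\<And>y. y \<in> span B \<Longrightarrow> orthogonal u y"
      using orthogonal_to_subspace_exists_gen[of B UNIV] by auto
    let ?V = "{x. \<forall>b\<in>B. x \<bullet> b = 0}"
    have "subspace ?V"
      by (auto simp: subspace_def inner_simps)
    moreover have "f ` ?V \<subseteq> ?V"
      using B by (fastforce simp: P_def sa)
    moreover have "u \<in> ?V"
      using u(2) by (simp add: orthogonal_def span_base)
    ultimately obtain v c where v: "v \<in> ?V" "norm v = 1" "f v = c *\<^sub>R v"
      using selfadjoint_eigenvector_subspace[OF lin sa, of ?V] u(1) by blast
    have "v \<notin> B"
      using v by (auto simp: norm_eq_1)
    moreover have "P (insert v B)"
      using B v by (auto simp: P_def pairwise_insert orthogonal_def inner_commute)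
    ultimately show False
      using max[of "insert v B"] fin by simp
  qed
  then show thesis
    using that fin B by (auto simp: P_def)
qed

section \<open>Square roots of symmetric nonnegative matrices\<close>

lemma symmetric_inner_matrix:
  fixes S :: "real^'k^'k"
  assumes "transpose S = S"
  shows "(S *v x) \<bullet> y = x \<bullet> (S *v y)"
  by (metis assms dot_lmul_matrix transpose_matrix_vector)

lemma symmetric_matrix_iff_selfadjoint:
  fixes S :: "real^'k^'k"
  shows "transpose S = S \<longleftrightarrow> (\<forall>x y. (S *v x) \<bullet> y = x \<bullet> (S *v y))"
proof
  assume "\<forall>x y. (S *v x) \<bullet> y = x \<bullet> (S *v y)"
  then have "transpose S *v x = S *v x" for x
    by (metis dot_lmul_matrix inner_commute transpose_matrix_vector vector_eq_ldot)
  then show "transpose S = S"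
    by (simp add: matrix_eq)
qed (simp add: symmetric_inner_matrix)

lemma matrix_eqI_span:
  fixes A B :: "real^'k^'m"
  assumes "span X = UNIV" and "\<And>x. x \<in> X \<Longrightarrow> A *v x = B *v x"
  shows "A = B"
  using linear_eq_on_span[of "(*v) A" "(*v) B" X] assms by (auto simp: matrix_eq)

text \<open>In an orthonormal eigenbasis of \<open>S\<close>, the root scales each \<open>b\<close>
  by \<open>sqrt (l b)\<close>; the eigenvalues \<open>l b\<close> are nonnegative because the form
  of \<open>S\<close> is.\<close>

lemma sym_nonneg_sqrt_exists:
  fixes S :: "real^'k^'k"
  assumes "sym_nonneg S"
  obtains R where "sym_nonneg R" "R ** R = S"
proof -
  have sym: "transpose S = S" and nn: "\<And>x. 0 \<le> x \<bullet> (S *v x)"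
    using assms by (auto simp: sym_nonneg_def)
  obtain B where fin: "finite B" and orth: "pairwise orthogonal B"
    and n1: "\<And>b. b \<in> B \<Longrightarrow> norm b = 1" and span: "span B = UNIV"
    and eig: "\<And>b. b \<in> B \<Longrightarrow> \<exists>c. S *v b = c *\<^sub>R b"
    using selfadjoint_eigenbasis[of "(*v) S"] symmetric_inner_matrix[OF sym] by blast
  obtain l where l: "\<And>b. b \<in> B \<Longrightarrow> S *v b = l b *\<^sub>R b"
    using eig by metis
  have l0: "0 \<le> l b" if "b \<in> B" for b
    using nn[of b] l[OF that] n1[OF that] by (simp add: dot_square_norm)
  let ?r = "\<lambda>x. \<Sum>b\<in>B. (sqrt (l b) * (b \<bullet> x)) *\<^sub>R b"
  have lin: "linear ?r"
    by (rule linearI) (simp_all add: inner_simps algebra_simps sum.distrib scaleR_sum_right)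
  define R where "R = matrix ?r"
  have R: "R *v x = ?r x" for x
    by (simp add: R_def matrix_works lin)
  have Rb: "R *v b = sqrt (l b) *\<^sub>R b" if b: "b \<in> B" for b
  proof -
    have "?r b = (\<Sum>d\<in>B. if d = b then sqrt (l b) *\<^sub>R b else 0)"
      using b orth n1 by (intro sum.cong refl)
        (auto simp: pairwise_def orthogonal_def dot_square_norm)
    also have "\<dots> = sqrt (l b) *\<^sub>R b"
      using b fin by simp
    finally show ?thesis
      by (simp add: R)
  qed
  have "transpose R = R"
    by (simp add: symmetric_matrix_iff_selfadjoint R inner_sum_left inner_sum_right mult_ac
        inner_commute)
  moreover have "0 \<le> x \<bullet> (R *v x)" for x
    unfolding R inner_sum_right
  proof (rule sum_nonneg)
    fix b assume "b \<in> B"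
    then show "0 \<le> x \<bullet> (sqrt (l b) * (b \<bullet> x)) *\<^sub>R b"
      using l0 by (simp add: inner_commute[of b x] mult.assoc)
  qed
  moreover have "R ** R = S"
    using l l0 Rb by (intro matrix_eqI_span[OF span])
      (simp add: matrix_vector_mul_assoc[symmetric] matrix_vector_mult_scaleR)
  ultimately show thesis
    using that[of R] by (simp add: sym_nonneg_def)
qed

text \<open>If \<open>c > 0\<close>, then \<open>R + sqrt c\<close> is injective and annihilates \<open>(R - sqrt c) v\<close>.\<close>

lemma sym_nonneg_sqrt_eigenvector:
  fixes R :: "real^'k^'k"
  assumes R: "sym_nonneg R" and v: "(R ** R) *v v = c *\<^sub>R v" and c: "0 \<le> c"
  shows "R *v v = sqrt c *\<^sub>R v"
proof -
  have sym: "transpose R = R" and nn: "\<And>x. 0 \<le> x \<bullet> (R *v x)"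
    using R by (auto simp: sym_nonneg_def)
  have Rv: "R *v (R *v v) = c *\<^sub>R v"
    using v by (simp add: matrix_vector_mul_assoc)
  show ?thesis
  proof (cases "c = 0")
    case True
    \<comment> \<open>For \<open>c = 0\<close> this says that \<open>R *v v\<close> has norm
      zero.\<close>
    have "(R *v v) \<bullet> (R *v v) = v \<bullet> (R *v (R *v v))"
      by (rule symmetric_inner_matrix[OF sym])
    with Rv True show ?thesis
      by simp
  next
    case False
    define u where "u = R *v v - sqrt c *\<^sub>R v"
    have "R *v u = - sqrt c *\<^sub>R u"
      using Rv c by (simp add: u_def algebra_simps)
    then have "0 \<le> - (sqrt c * (u \<bullet> u))"
      using nn[of u] by simp
    then have "u \<bullet> u \<le> 0"
      using False c by (simp add: mult_le_0_iff)
    then have "u = 0"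
      by (metis inner_gt_zero_iff not_le)
    then show ?thesis
      by (simp add: u_def)
  qed
qed

text \<open>On an eigenbasis of \<open>R ** R\<close>, both roots act as multiplication by the
  square root of the eigenvalue.\<close>

lemma sym_nonneg_sqrt_unique:
  fixes R T :: "real^'k^'k"
  assumes R: "sym_nonneg R" and T: "sym_nonneg T" and eq: "R ** R = T ** T"
  shows "R = T"
proof -
  have sym: "transpose R = R"
    using R by (simp add: sym_nonneg_def)
  then have "transpose (R ** R) = R ** R"
    by (simp add: matrix_transpose_mul)
  then obtain B where span: "span B = UNIV" and n1: "\<And>b. b \<in> B \<Longrightarrow> norm b = 1"
    and eig: "\<And>b. b \<in> B \<Longrightarrow> \<exists>c. (R ** R) *v b = c *\<^sub>R b"
    using selfadjoint_eigenbasis[of "(*v) (R ** R)", OF matrix_vector_mul_linear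
        symmetric_inner_matrix] by metis
  show ?thesis
  proof (rule matrix_eqI_span[OF span])
    fix b assume b: "b \<in> B"
    then obtain c where c: "(R ** R) *v b = c *\<^sub>R b"
      using eig by blast
    \<comment> \<open>The eigenvalue \<open>c\<close> is the squared norm of \<open>R *v b\<close>,
      hence nonnegative.\<close>
    have "(R *v b) \<bullet> (R *v b) = b \<bullet> (R *v (R *v b))"
      by (rule symmetric_inner_matrix[OF sym])
    also have "\<dots> = c"
      using c n1[OF b] by (simp add: matrix_vector_mul_assoc dot_square_norm)
    finally have "0 \<le> c"
      by (metis inner_ge_zero)
    then show "R *v b = T *v b"
      using sym_nonneg_sqrt_eigenvector[OF R c] sym_nonneg_sqrt_eigenvector[OF T] c eq by metis
  qed
qed

text \<open>Existence and uniqueness of the root give the definite description in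
  \<open>matrix_sqrt\<close> its meaning.\<close>

lemma matrix_sqrt:
  fixes S :: "real^'k^'k"
  assumes "sym_nonneg S"
  shows sym_nonneg_matrix_sqrt: "sym_nonneg (matrix_sqrt S)"
    and matrix_sqrt_mult_self: "matrix_sqrt S ** matrix_sqrt S = S"
proof -
  have "\<exists>!R. sym_nonneg R \<and> R ** R = S"
    using sym_nonneg_sqrt_exists[OF assms] sym_nonneg_sqrt_unique by metis
  from theI'[OF this] show "sym_nonneg (matrix_sqrt S)" "matrix_sqrt S ** matrix_sqrt S = S"
    by (simp_all add: matrix_sqrt_def)
qed

section \<open>Inverses and weighted norms\<close>

lemma matrix_inv:
  assumes "invertible M"
  shows matrix_inv_right: "M ** matrix_inv M = mat 1"
    and matrix_inv_left: "matrix_inv M ** M = mat 1"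
  using someI_ex[OF assms[unfolded invertible_def]] by (auto simp: matrix_inv_def)

lemma matrix_inv_unique:
  fixes M :: "'a::semiring_1^'n^'m"
  assumes "M ** X = mat 1" "X ** M = mat 1"
  shows "matrix_inv M = X"
  by (metis assms invertible_def matrix_inv_left matrix_mul_assoc matrix_mul_lid matrix_mul_rid)

lemma matrix_inv_matrix_inv:
  assumes "invertible M"
  shows "matrix_inv (matrix_inv M) = M"
  by (simp add: assms matrix_inv matrix_inv_unique)

text \<open>Cancelling \<open>M\<close> on both sides of \<open>M ** X ** M = M\<close> leaves the
  inverse as the only candidate.\<close>

lemma pseudo_inverse_invertible:
  fixes M :: "real^'k^'k"
  assumes "invertible M"
  shows "pseudo_inverse M = matrix_inv M"
  unfolding pseudo_inverse_def
proof (rule the_equality)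
  show "is_pseudo_inverse M (matrix_inv M)"
    by (simp add: is_pseudo_inverse_def matrix_inv[OF assms])
next
  fix X assume "is_pseudo_inverse M X"
  then have "M ** X ** M = M"
    by (simp add: is_pseudo_inverse_def)
  then show "X = matrix_inv M"
    by (metis assms matrix_inv matrix_mul_assoc matrix_mul_lid matrix_mul_rid)
qed

lemma sym_nonneg_matrix_inv:
  fixes S :: "real^'k^'k"
  assumes S: "sym_nonneg S" and inv: "invertible S"
  shows "sym_nonneg (matrix_inv S)"
proof -
  let ?W = "matrix_inv S"
  have sym: "transpose S = S"
    using S by (simp add: sym_nonneg_def)
  have "transpose ?W = matrix_inv S"
    by (metis inv matrix_inv matrix_inv_unique matrix_transpose_mul sym transpose_mat)
  moreover have "0 \<le> x \<bullet> (?W *v x)" for x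
  proof -
    \<comment> \<open>With \<open>y = ?W *v x\<close>, the form of the inverse at \<open>x\<close>
      becomes the form of \<open>S\<close> at \<open>y\<close>.\<close>
    have "x = S *v (?W *v x)"
      by (simp add: matrix_vector_mul_assoc matrix_inv[OF inv])
    then show ?thesis
      using S by (metis inner_commute sym_nonneg_def)
  qed
  ultimately show ?thesis
    by (simp add: sym_nonneg_def)
qed

section \<open>Regularized Gram matrices\<close>

lemma inner_regularized_Gram:
  fixes Z :: "real^'k^'n"
  shows "x \<bullet> ((\<gamma> *\<^sub>R mat 1 + (1 - \<gamma>) *\<^sub>R (transpose Z ** Z)) *v x) =
    \<gamma> * (x \<bullet> x) + (1 - \<gamma>) * ((Z *v x) \<bullet> (Z *v x))"
proof -
  have "x \<bullet> ((transpose Z ** Z) *v x) = (Z *v x) \<bullet> (Z *v x)"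
    by (metis dot_lmul_matrix inner_commute matrix_vector_mul_assoc transpose_matrix_vector)
  then show ?thesis
    by (simp add: matrix_vector_mult_add_rdistrib scaleR_matrix_vector_assoc[symmetric]
        inner_add_right)
qed

lemma sym_nonneg_regularized_Gram:
  fixes Z :: "real^'k^'n"
  assumes "0 \<le> \<gamma>" "\<gamma> \<le> 1"
  shows "sym_nonneg (\<gamma> *\<^sub>R mat 1 + (1 - \<gamma>) *\<^sub>R (transpose Z ** Z))"
    (is "sym_nonneg ?S")
proof -
  have "transpose ?S = ?S"
    by (simp add: vec_eq_iff transpose_def mat_def matrix_matrix_mult_def mult.commute)
  then show ?thesis
    using assms by (simp add: sym_nonneg_def inner_regularized_Gram)
qed

text \<open>For \<gamma> > 0 the quadratic form is at least \<gamma> times the squared norm, so the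
  kernel is trivial; for \<gamma> = 0 the matrix is \<open>transpose Z ** Z\<close> itself.\<close>

lemma invertible_regularized_Gram:
  fixes Z :: "real^'k^'n"
  assumes "0 \<le> \<gamma>" "\<gamma> \<le> 1" "0 < \<gamma> \<or> invertible (transpose Z ** Z)"
  shows "invertible (\<gamma> *\<^sub>R mat 1 + (1 - \<gamma>) *\<^sub>R (transpose Z ** Z))"
    (is "invertible ?S")
proof (cases "\<gamma> = 0")
  case False
  have "x = 0" if "?S *v x = 0" for x
  proof -
    have "0 = \<gamma> * (x \<bullet> x) + (1 - \<gamma>) * ((Z *v x) \<bullet> (Z *v x))"
      using inner_regularized_Gram[of x \<gamma> Z] that by simp
    moreover have "0 \<le> (1 - \<gamma>) * ((Z *v x) \<bullet> (Z *v x))" "0 \<le> \<gamma> * (x \<bullet> x)"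
      using assms by simp_all
    ultimately have "\<gamma> * (x \<bullet> x) = 0"
      by linarith
    then show "x = 0"
      using False by simp
  qed
  then show ?thesis
    by (simp add: invertible_left_inverse matrix_left_invertible_ker)
qed (use assms in simp)

section \<open>Weighted norms and their relation to \<open>Psi\<close>\<close>

lemma row_matrix_mult: "row i (A ** B) = row i A v* B"
  by (simp add: vec_eq_iff row_def matrix_matrix_mult_def vector_matrix_mult_def)

lemma weighted_norm_eq: "weighted_norm W z = sqrt (z \<bullet> (W *v z))"
  by (simp add: weighted_norm_def dot_lmul_matrix)

text \<open>The root \<open>R\<close> is symmetric, so the squared norm of \<open>z v* R\<close> is
  the form of \<open>R ** R = S\<close> at \<open>z\<close>. This links the row norms in
  \<open>Psi\<close> to weighted norms.\<close>

lemma weighted_norm_matrix_sqrt: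
  fixes S :: "real^'k^'k"
  assumes "sym_nonneg S"
  shows "weighted_norm S z = norm (z v* matrix_sqrt S)"
proof -
  let ?R = "matrix_sqrt S"
  have "transpose ?R = ?R"
    using sym_nonneg_matrix_sqrt[OF assms] by (simp add: sym_nonneg_def)
  then have "z v* ?R = ?R *v z"
    by (metis transpose_matrix_vector)
  then have "(z v* ?R) \<bullet> (z v* ?R) = z \<bullet> (S *v z)"
    by (metis assms dot_lmul_matrix matrix_sqrt_mult_self matrix_vector_mul_assoc)
  then show ?thesis
    by (simp add: weighted_norm_eq norm_eq_sqrt_inner)
qed

text \<open>If the form vanished at \<open>z\<close>, the root would annihilate \<open>z\<close>,
  hence so would \<open>S\<close>. Positivity is what later allows the square root to be
  differentiated at nonzero rows.\<close>

lemma sym_nonneg_invertible_pos: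
  fixes S :: "real^'k^'k"
  assumes S: "sym_nonneg S" and inv: "invertible S" and z: "z \<noteq> 0"
  shows "0 < z \<bullet> (S *v z)"
proof -
  have "z v* matrix_sqrt S \<noteq> 0"
  proof
    assume "z v* matrix_sqrt S = 0"
    then have "z v* S = 0"
      by (metis S matrix_sqrt_mult_self vector_matrix_mul_assoc vector_matrix_mult_0)
    then have "z v* (S ** matrix_inv S) = 0"
      by (metis vector_matrix_mul_assoc vector_matrix_mult_0)
    then show False
      using z by (simp add: matrix_inv[OF inv])
  qed
  then have "0 < weighted_norm S z"
    by (simp add: weighted_norm_matrix_sqrt[OF S])
  then show ?thesis
    by (simp add: weighted_norm_eq)
qed

text \<open>In the invertible case the pseudo-inverse is the inverse, and row \<open>i\<close> of
  the product in \<open>Psi\<close> is \<open>row i Z\<close> times its root.\<close>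

lemma Psi_eq_sum_weighted_norm:
  fixes \<gamma> :: real and Z :: "real^'k^'n"
  defines "S \<equiv> \<gamma> *\<^sub>R mat 1 + (1 - \<gamma>) *\<^sub>R (transpose Z ** Z)"
  assumes "0 \<le> \<gamma>" "\<gamma> \<le> 1" "invertible S"
  shows "Psi \<gamma> Z = (\<Sum>i\<in>UNIV. weighted_norm (matrix_inv S) (row i Z))"
proof -
  have S: "sym_nonneg S"
    using assms by (simp add: sym_nonneg_regularized_Gram)
  show ?thesis
    unfolding weighted_norm_matrix_sqrt[OF sym_nonneg_matrix_inv[OF S assms(4)]]
    unfolding pseudo_inverse_invertible[OF assms(4), symmetric]
    by (simp add: Psi_def norm_2_1_def row_matrix_mult S_def)
qed

section \<open>Differentiating matrix-valued curves\<close>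

lemma matrix_add_rdistrib: "(A + B) ** C = A ** C + B ** C"
  by (simp add: matrix_matrix_mult_def vec_eq_iff distrib_right sum.distrib)

lemma bounded_bilinear_matrix_matrix_mult:
  "bounded_bilinear ((**) :: real^'n^'m \<Rightarrow> real^'p^'n \<Rightarrow> real^'p^'m)"
  unfolding bilinear_conv_bounded_bilinear[symmetric] bilinear_def
  by (auto intro!: linearI simp: matrix_add_ldistrib matrix_add_rdistrib scalar_matrix_assoc
      matrix_scalar_ac)

lemma bounded_bilinear_matrix_vector_mult:
  "bounded_bilinear ((*v) :: real^'n^'m \<Rightarrow> real^'n \<Rightarrow> real^'m)"
  unfolding bilinear_conv_bounded_bilinear[symmetric] bilinear_def
  by (auto intro!: linearI simp: matrix_vector_mult_add_rdistrib scaleR_matrix_vector_assoc)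

lemma bounded_bilinear_vector_matrix_mult:
  "bounded_bilinear ((v*) :: real^'m \<Rightarrow> real^'n^'m \<Rightarrow> real^'n)"
  unfolding bilinear_conv_bounded_bilinear[symmetric] bilinear_def
  by (auto intro!: linearI simp: vector_matrix_mult_add_rdistrib vector_matrix_left_distrib
      vector_scaleR_matrix_ac scaleR_vector_matrix_assoc)

lemmas has_vector_derivative_matrix_matrix_mult =
  bounded_bilinear.has_vector_derivative[OF bounded_bilinear_matrix_matrix_mult]
lemmas has_vector_derivative_matrix_vector_mult =
  bounded_bilinear.has_vector_derivative[OF bounded_bilinear_matrix_vector_mult]
lemmas tendsto_matrix_matrix_mult =
  bounded_bilinear.tendsto[OF bounded_bilinear_matrix_matrix_mult]
lemmas tendsto_matrix_vector_mult =
  bounded_bilinear.tendsto[OF bounded_bilinear_matrix_vector_mult]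

section \<open>Continuity and derivative of matrix inversion\<close>

lemma tendsto_det:
  fixes f :: "'a \<Rightarrow> real^'n^'n"
  assumes "(f \<longlongrightarrow> M) F"
  shows "((\<lambda>x. det (f x)) \<longlongrightarrow> det M) F"
  unfolding det_def by (intro tendsto_intros assms)

lemma eventually_invertible:
  fixes f :: "'a \<Rightarrow> real^'n^'n"
  assumes "(f \<longlongrightarrow> M) F" "invertible M"
  shows "\<forall>\<^sub>F x in F. invertible (f x)"
  using tendsto_imp_eventually_ne[OF tendsto_det[OF assms(1)], of 0] assms(2)
  by (simp add: invertible_det_nz)

text \<open>Cramer's rule for \<open>M *v x = axis j 1\<close>, whose solution is column
  \<open>j\<close> of the inverse. It exhibits the entries as quotients of determinants, from which
  continuity of inversion follows.\<close>

lemma matrix_inv_nth: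
  fixes M :: "real^'n^'n"
  assumes "invertible M"
  shows "matrix_inv M $ k $ j =
    det (\<chi> i l. if l = k then axis j 1 $ i else M $ i $ l) / det M"
proof -
  have "M *v (matrix_inv M *v axis j 1) = axis j 1"
    by (simp add: matrix_vector_mul_assoc matrix_inv_right[OF assms])
  then have "matrix_inv M *v axis j 1 =
      (\<chi> k. det (\<chi> i l. if l = k then axis j 1 $ i else M $ i $ l) / det M)"
    using cramer[of M] assms by (simp add: invertible_det_nz)
  moreover have "(matrix_inv M *v axis j 1) $ k = matrix_inv M $ k $ j"
    by (simp add: matrix_vector_mul_component inner_axis)
  ultimately show ?thesis
    by simp
qed

lemma tendsto_matrix_inv:
  fixes f :: "'a \<Rightarrow> real^'n^'n"
  assumes f: "(f \<longlongrightarrow> M) F" and inv: "invertible M"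
  shows "((\<lambda>x. matrix_inv (f x)) \<longlongrightarrow> matrix_inv M) F"
proof (intro vec_tendstoI)
  fix k j
  let ?g = "\<lambda>M. (\<chi> i l. if l = k then axis j 1 $ i else M $ i $ l) :: real^'n^'n"
  have "((\<lambda>x. ?g (f x)) \<longlongrightarrow> ?g M) F"
    using f by (intro vec_tendstoI) (auto intro!: tendsto_intros)
  then have "((\<lambda>x. det (?g (f x)) / det (f x)) \<longlongrightarrow> det (?g M) / det M) F"
    using inv f by (intro tendsto_divide tendsto_det) (simp_all add: invertible_det_nz)
  moreover have "\<forall>\<^sub>F x in F. det (?g (f x)) / det (f x) = matrix_inv (f x) $ k $ j"
    using eventually_invertible[OF f inv] by eventually_elim (simp add: matrix_inv_nth)
  ultimately show "((\<lambda>x. matrix_inv (f x) $ k $ j) \<longlongrightarrow> matrix_inv M $ k $ j) F"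
    by (simp add: matrix_inv_nth[OF inv] Lim_transform_eventually)
qed

text \<open>The difference-quotient form serves both the derivative of the inverse and the one-sided
  derivative at vanishing rows.\<close>

lemma has_vector_derivative_iff_tendsto:
  fixes f :: "real \<Rightarrow> 'a::real_normed_vector"
  shows "(f has_vector_derivative D) (at x within S) \<longleftrightarrow>
    ((\<lambda>y. (f y - f x) /\<^sub>R (y - x)) \<longlongrightarrow> D) (at x within S)"
proof -
  have "norm (f y - f x - (y - x) *\<^sub>R D) / norm (y - x) = norm ((f y - f x) /\<^sub>R (y - x) - D)"
    if "y \<noteq> x" for y
  proof -
    have "f y - f x - (y - x) *\<^sub>R D = (y - x) *\<^sub>R ((f y - f x) /\<^sub>R (y - x) - D)"
      using that by (simp add: scaleR_diff_right)
    then show ?thesis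
      using that by (simp only: norm_scaleR) simp
  qed
  then have ev: "\<forall>\<^sub>F y in at x within S. norm (f y - f x - (y - x) *\<^sub>R D) / norm (y - x) =
      norm ((f y - f x) /\<^sub>R (y - x) - D)"
    by (auto simp: eventually_at_filter)
  show ?thesis
    unfolding has_vector_derivative_def has_derivative_iff_norm tendsto_cong[OF ev]
    by (simp add: bounded_linear_scaleR_left tendsto_norm_zero_iff flip: Lim_null)
qed

text \<open>The resolvent identity, by expanding the product on the right.\<close>

lemma matrix_inv_diff:
  fixes M N :: "real^'n^'n"
  assumes "invertible M" "invertible N"
  shows "matrix_inv M - matrix_inv N = - (matrix_inv M ** (M - N) ** matrix_inv N)"
proof -
  have "matrix_inv M ** (M - N) ** matrix_inv N =
      matrix_inv M ** M ** matrix_inv N - matrix_inv M ** (N ** matrix_inv N)"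
    by (simp add: matrix_mul_assoc bounded_bilinear.diff_left bounded_bilinear.diff_right
        bounded_bilinear_matrix_matrix_mult)
  then show ?thesis
    by (simp add: matrix_inv[OF assms(1)] matrix_inv[OF assms(2)])
qed

text \<open>By the resolvent identity the difference quotient of the inverse is that of
  \<open>f\<close>, multiplied by an inverse on each side; continuity of inversion gives the
  limit.\<close>

lemma has_vector_derivative_matrix_inv:
  fixes f :: "real \<Rightarrow> real^'n^'n"
  assumes f: "(f has_vector_derivative D) (at x within S)" and inv: "invertible (f x)"
  shows "((\<lambda>y. matrix_inv (f y)) has_vector_derivative
    - (matrix_inv (f x) ** D ** matrix_inv (f x))) (at x within S)"
  unfolding has_vector_derivative_iff_tendsto
proof (rule Lim_transform_eventually)
  have lim: "(f \<longlongrightarrow> f x) (at x within S)"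
    using has_vector_derivative_continuous[OF f] by (simp add: continuous_within)
  show "((\<lambda>y. - (matrix_inv (f y) ** ((f y - f x) /\<^sub>R (y - x)) ** matrix_inv (f x))) \<longlongrightarrow>
      - (matrix_inv (f x) ** D ** matrix_inv (f x))) (at x within S)"
    using f unfolding has_vector_derivative_iff_tendsto
    by (intro tendsto_minus tendsto_matrix_matrix_mult tendsto_matrix_inv lim inv tendsto_const)
  show "\<forall>\<^sub>F y in at x within S.
      - (matrix_inv (f y) ** ((f y - f x) /\<^sub>R (y - x)) ** matrix_inv (f x)) =
      (matrix_inv (f y) - matrix_inv (f x)) /\<^sub>R (y - x)"
    using eventually_invertible[OF lim inv]
    by eventually_elim (simp add: matrix_inv_diff inv matrix_scalar_ac scalar_matrix_assoc[symmetric])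
qed

text \<open>Product rule; symmetry of \<open>M x\<close> merges the two terms in \<open>z'\<close>
  into the factor 2.\<close>

lemma has_real_derivative_quadratic_form:
  fixes z :: "real \<Rightarrow> real^'k" and M :: "real \<Rightarrow> real^'k^'k"
  assumes z: "(z has_vector_derivative z') (at x within S)"
    and M: "(M has_vector_derivative M') (at x within S)"
    and sym: "transpose (M x) = M x"
  shows "((\<lambda>t. z t \<bullet> (M t *v z t)) has_real_derivative
    2 * (z' \<bullet> (M x *v z x)) + z x \<bullet> (M' *v z x)) (at x within S)"
proof -
  have "((\<lambda>t. z t \<bullet> (M t *v z t)) has_vector_derivative
      z x \<bullet> (M x *v z' + M' *v z x) + z' \<bullet> (M x *v z x)) (at x within S)"
    by (intro bounded_bilinear.has_vector_derivative[OF bounded_bilinear_inner]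
        has_vector_derivative_matrix_vector_mult z M)
  moreover have "z x \<bullet> (M x *v z') = z' \<bullet> (M x *v z x)"
    by (metis inner_commute symmetric_inner_matrix[OF sym])
  ultimately show ?thesis
    by (simp add: has_real_derivative_iff_has_vector_derivative inner_add_right algebra_simps)
qed

section \<open>The directional derivative of \<open>J\<close>\<close>

lemma transpose_add: "transpose (A + B) = transpose A + transpose B"
  by (simp add: transpose_def vec_eq_iff)

lemma has_vector_derivative_regularized_Gram:
  fixes Z E :: "real^'k^'n"
  shows "((\<lambda>t. \<gamma> *\<^sub>R mat 1 + (1 - \<gamma>) *\<^sub>R (transpose (Z + t *\<^sub>R E) ** (Z + t *\<^sub>R E)))
    has_vector_derivative (1 - \<gamma>) *\<^sub>R (transpose Z ** E + transpose E ** Z)) (at 0 within S)"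
proof -
  have lin: "((\<lambda>t. P + t *\<^sub>R Q) has_vector_derivative Q) (at 0 within S)"
    for P Q :: "'a::real_normed_vector"
    by (auto intro!: derivative_eq_intros)
  have "((\<lambda>t. (transpose Z + t *\<^sub>R transpose E) ** (Z + t *\<^sub>R E))
      has_vector_derivative transpose Z ** E + transpose E ** Z) (at 0 within S)"
    using has_vector_derivative_matrix_matrix_mult[OF lin[of "transpose Z" "transpose E"]
        lin[of Z E]] by simp
  then show ?thesis
    by (auto intro!: derivative_eq_intros simp: transpose_add transpose_scalar)
qed

text \<open>Rows of \<open>Z\<close> that vanish contribute the one-sided derivative of \<open>t \<mapsto> t * \<parallel>e\<parallel>\<close>; hence the
  restriction to \<open>t \<ge> 0\<close>.\<close>

lemma Psi_directional_derivative:
  fixes \<gamma> :: real and Z E :: "real^'k^'n"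
  defines "W \<equiv> matrix_inv (\<gamma> *\<^sub>R mat 1 + (1 - \<gamma>) *\<^sub>R (transpose Z ** Z))"
  assumes \<gamma>: "0 \<le> \<gamma>" "\<gamma> \<le> 1" and inv: "0 < \<gamma> \<or> invertible (transpose Z ** Z)"
  shows "((\<lambda>t. Psi \<gamma> (Z + t *\<^sub>R E)) has_real_derivative
    (\<Sum>i\<in>UNIV. if row i Z = 0 then weighted_norm W (row i E)
      else (row i E \<bullet> (W *v row i Z) -
        (1 - \<gamma>) * ((Z *v (W *v row i Z)) \<bullet> (E *v (W *v row i Z)))) / weighted_norm W (row i Z)))
    (at 0 within {0..})"
proof -
  define S where "S t = \<gamma> *\<^sub>R mat 1 +
    (1 - \<gamma>) *\<^sub>R (transpose (Z + t *\<^sub>R E) ** (Z + t *\<^sub>R E))" for t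
  define M where "M t = matrix_inv (S t)" for t
  define P where "P = (1 - \<gamma>) *\<^sub>R (transpose Z ** E + transpose E ** Z)"
  have P_mult: "P *v u =
      (1 - \<gamma>) *\<^sub>R (transpose Z *v (E *v u) + transpose E *v (Z *v u))" for u
    by (simp only: P_def scaleR_matrix_vector_assoc[symmetric] matrix_vector_mult_add_rdistrib
        matrix_vector_mul_assoc)
  have M0: "M 0 = W"
    by (simp add: M_def S_def W_def)
  have inv0: "invertible (S 0)"
    using invertible_regularized_Gram[OF \<gamma> inv] by (simp add: S_def)
  have S': "(S has_vector_derivative P) (at 0 within {0..})"
    unfolding S_def P_def by (rule has_vector_derivative_regularized_Gram)
  have S_lim: "(S \<longlongrightarrow> S 0) (at 0 within {0..})"
    using has_vector_derivative_continuous[OF S'] by (simp add: continuous_within)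
  have M_lim: "(M \<longlongrightarrow> W) (at 0 within {0..})"
    using tendsto_matrix_inv[OF S_lim inv0] by (simp add: M_def[abs_def] flip: M0)
  have M': "(M has_vector_derivative - (W ** P ** W)) (at 0 within {0..})"
    using has_vector_derivative_matrix_inv[OF S' inv0] by (simp add: M_def[abs_def] flip: M0)
  have W: "sym_nonneg W" "invertible W"
    using sym_nonneg_matrix_inv[of "S 0"] sym_nonneg_regularized_Gram[OF \<gamma>, of Z] inv0
      matrix_inv[OF inv0]
    by (auto simp: S_def W_def invertible_def)
  then have symW: "transpose W = W"
    by (simp add: sym_nonneg_def)
  let ?f = "\<lambda>t i. weighted_norm (M t) (row i Z + t *\<^sub>R row i E)"
  have f_eq: "?f t i =
      sqrt ((row i Z + t *\<^sub>R row i E) \<bullet> (M t *v (row i Z + t *\<^sub>R row i E)))" for t i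
    by (simp add: weighted_norm_eq)
  have "((\<lambda>t. \<Sum>i\<in>UNIV. ?f t i) has_real_derivative
    (\<Sum>i\<in>UNIV. if row i Z = 0 then weighted_norm W (row i E)
      else (row i E \<bullet> (W *v row i Z) -
        (1 - \<gamma>) * ((Z *v (W *v row i Z)) \<bullet> (E *v (W *v row i Z)))) / weighted_norm W (row i Z)))
    (at 0 within {0..})"
  proof (rule DERIV_sum)
    fix i :: 'n
    let ?z = "row i Z" and ?e = "row i E"
    show "((\<lambda>t. ?f t i) has_real_derivative (if ?z = 0 then weighted_norm W ?e
      else (?e \<bullet> (W *v ?z) - (1 - \<gamma>) * ((Z *v (W *v ?z)) \<bullet> (E *v (W *v ?z)))) / weighted_norm W ?z))
      (at 0 within {0..})"
    proof (cases "?z = 0")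
      case True
      have "((\<lambda>t. sqrt (?e \<bullet> (M t *v ?e))) \<longlongrightarrow> sqrt (?e \<bullet> (W *v ?e))) (at 0 within {0..})"
        by (intro tendsto_intros tendsto_matrix_vector_mult M_lim)
      moreover have "\<forall>\<^sub>F t in at 0 within {0..}.
          sqrt (?e \<bullet> (M t *v ?e)) = (?f t i - ?f 0 i) /\<^sub>R (t - 0)"
        unfolding eventually_at_filter
      proof (intro always_eventually allI impI)
        \<comment> \<open>The row is \<open>t *\<^sub>R ?e\<close> and \<open>t\<close> is positive
          here, so \<open>t\<close> comes out of the square root and the quotient is exactly the
          norm of \<open>?e\<close> weighted by \<open>M t\<close>.\<close>
        fix t :: real assume t: "t \<noteq> 0" "t \<in> {0..}"
        have "(t *\<^sub>R ?e) \<bullet> (M t *v (t *\<^sub>R ?e)) = t\<^sup>2 * (?e \<bullet> (M t *v ?e))"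
          by (simp add: matrix_vector_mult_scaleR power2_eq_square)
        then show "sqrt (?e \<bullet> (M t *v ?e)) = (?f t i - ?f 0 i) /\<^sub>R (t - 0)"
          using t True by (simp add: weighted_norm_eq real_sqrt_mult)
      qed
      ultimately show ?thesis
        using True unfolding has_real_derivative_iff_has_vector_derivative
          has_vector_derivative_iff_tendsto
        by (simp add: Lim_transform_eventually weighted_norm_eq)
    next
      case False
      let ?u = "W *v ?z"
      have pos: "0 < ?z \<bullet> (W *v ?z)"
        using sym_nonneg_invertible_pos[OF W False] .
      have "((\<lambda>t. ?z + t *\<^sub>R ?e) has_vector_derivative ?e) (at 0 within {0..})"
        by (auto intro!: derivative_eq_intros)
      from has_real_derivative_quadratic_form[OF this M'] symW M0
      have "((\<lambda>t. (?z + t *\<^sub>R ?e) \<bullet> (M t *v (?z + t *\<^sub>R ?e))) has_real_derivative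
          2 * (?e \<bullet> ?u) + ?z \<bullet> (- (W ** P ** W) *v ?z)) (at 0 within {0..})"
        by simp
      \<comment> \<open>Moving \<open>W\<close> to both sides leaves the form of \<open>P\<close> at
        \<open>?u\<close>; the two summands of \<open>P\<close> are transposes of each other and
        contribute equally.\<close>
      moreover have "?z \<bullet> (- (W ** P ** W) *v ?z) = - (2 * (1 - \<gamma>) * ((Z *v ?u) \<bullet> (E *v ?u)))"
      proof -
        have "?z \<bullet> ((W ** P ** W) *v ?z) = ?u \<bullet> (P *v ?u)"
          by (metis matrix_vector_mul_assoc symmetric_inner_matrix[OF symW])
        also have "\<dots> = (1 - \<gamma>) * (?u \<bullet> (transpose Z *v (E *v ?u)) + ?u \<bullet> (transpose E *v (Z *v ?u)))"
          by (simp only: P_mult inner_scaleR_right inner_add_right)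
        also have "?u \<bullet> (transpose Z *v (E *v ?u)) = (Z *v ?u) \<bullet> (E *v ?u)"
          by (metis dot_lmul_matrix vector_transpose_matrix)
        also have "?u \<bullet> (transpose E *v (Z *v ?u)) = (Z *v ?u) \<bullet> (E *v ?u)"
          by (metis dot_lmul_matrix inner_commute vector_transpose_matrix)
        finally have "?z \<bullet> ((W ** P ** W) *v ?z) = 2 * (1 - \<gamma>) * ((Z *v ?u) \<bullet> (E *v ?u))"
          by simp
        then show ?thesis
          by (simp add: bounded_bilinear.minus_left[OF bounded_bilinear_matrix_vector_mult])
      qed
      ultimately have q: "((\<lambda>t. (?z + t *\<^sub>R ?e) \<bullet> (M t *v (?z + t *\<^sub>R ?e))) has_real_derivative
          2 * (?e \<bullet> ?u - (1 - \<gamma>) * ((Z *v ?u) \<bullet> (E *v ?u)))) (at 0 within {0..})"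
        by (simp add: algebra_simps)
      \<comment> \<open>Chain rule for the square root, legitimate since \<open>pos\<close> keeps
        its argument away from zero at \<open>t = 0\<close>.\<close>
      have "((\<lambda>t. ?f t i) has_real_derivative
          inverse (sqrt (?z \<bullet> ?u)) / 2 * (2 * (?e \<bullet> ?u - (1 - \<gamma>) * ((Z *v ?u) \<bullet> (E *v ?u)))))
          (at 0 within {0..})"
        unfolding f_eq
        by (rule DERIV_chain2[OF _ q]) (use pos M0 in \<open>auto intro!: DERIV_real_sqrt\<close>)
      also have "inverse (sqrt (?z \<bullet> ?u)) / 2 * (2 * (?e \<bullet> ?u - (1 - \<gamma>) * ((Z *v ?u) \<bullet> (E *v ?u)))) =
          (?e \<bullet> ?u - (1 - \<gamma>) * ((Z *v ?u) \<bullet> (E *v ?u))) / weighted_norm W ?z"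
        using pos by (simp add: weighted_norm_eq field_simps)
      finally show ?thesis
        using False by simp
    qed
  qed
  moreover have "row i (Z + t *\<^sub>R E) = row i Z + t *\<^sub>R row i E" for i t
    by (simp add: row_def vec_eq_iff)
  then have Psi: "Psi \<gamma> (Z + t *\<^sub>R E) = (\<Sum>i\<in>UNIV. ?f t i)" if "invertible (S t)" for t
    using Psi_eq_sum_weighted_norm[OF \<gamma>, of "Z + t *\<^sub>R E"] that by (simp add: S_def M_def)
  \<comment> \<open>The formula for \<open>Psi\<close> holds where \<open>S t\<close> is invertible,
    that is, for \<open>t\<close> near 0. The filter omits \<open>t = 0\<close>, so the value there
    is supplied separately by \<open>Psi[OF inv0]\<close>.\<close>
  have ev: "\<forall>\<^sub>F t in at 0 within {0..}. Psi \<gamma> (Z + t *\<^sub>R E) = (\<Sum>i\<in>UNIV. ?f t i)"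
    by (rule eventually_mono[OF eventually_invertible[OF S_lim inv0] Psi])
  ultimately show ?thesis
    using has_field_derivative_cong_eventually[OF ev Psi[OF inv0]] by (simp only:)
qed

text \<open>Left multiplication by \<open>transpose A\<close> is adjoint to left multiplication by
  \<open>A\<close> in the Frobenius inner product; the proof reorders a triple sum.\<close>

lemma inner_matrix_mult:
  fixes A :: "real^'n^'m" and X :: "real^'k^'m" and E :: "real^'k^'n"
  shows "X \<bullet> (A ** E) = (transpose A ** X) \<bullet> E"
proof -
  have "X \<bullet> (A ** E) = (\<Sum>i\<in>UNIV. \<Sum>j\<in>UNIV. \<Sum>l\<in>UNIV. A $ i $ l * X $ i $ j * E $ l $ j)"
    by (simp add: inner_vec_def matrix_matrix_mult_def sum_distrib_left mult_ac)
  also have "\<dots> = (\<Sum>i\<in>UNIV. \<Sum>l\<in>UNIV. \<Sum>j\<in>UNIV. A $ i $ l * X $ i $ j * E $ l $ j)"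
    by (intro sum.cong refl sum.swap)
  also have "\<dots> = (\<Sum>l\<in>UNIV. \<Sum>i\<in>UNIV. \<Sum>j\<in>UNIV. A $ i $ l * X $ i $ j * E $ l $ j)"
    by (rule sum.swap)
  also have "\<dots> = (\<Sum>l\<in>UNIV. \<Sum>j\<in>UNIV. \<Sum>i\<in>UNIV. A $ i $ l * X $ i $ j * E $ l $ j)"
    by (intro sum.cong refl sum.swap)
  also have "\<dots> = (transpose A ** X) \<bullet> E"
    by (simp add: inner_vec_def matrix_matrix_mult_def transpose_def sum_distrib_right)
  finally show ?thesis .
qed

text \<open>The difference quotients from the right are eventually nonnegative, and so is their
  limit.\<close>

lemma local_minimum_directional_derivative_nonneg:
  fixes f :: "'a::real_normed_vector \<Rightarrow> real"
  assumes min: "local_minimum f x"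
    and D: "((\<lambda>t. f (x + t *\<^sub>R v)) has_real_derivative D) (at 0 within {0..})"
  shows "0 \<le> D"
proof (rule tendsto_lowerbound)
  show "((\<lambda>t. (f (x + t *\<^sub>R v) - f (x + 0 *\<^sub>R v)) /\<^sub>R (t - 0)) \<longlongrightarrow> D) (at 0 within {0..})"
    using D by (simp only: has_real_derivative_iff_has_vector_derivative
        has_vector_derivative_iff_tendsto)
  have "((\<lambda>t. x + t *\<^sub>R v) \<longlongrightarrow> x + 0 *\<^sub>R v) (at 0 within {0..})"
    by (intro tendsto_intros)
  then have "\<forall>\<^sub>F t in at 0 within {0..}. f x \<le> f (x + t *\<^sub>R v)"
    using min unfolding local_minimum_def filterlim_iff scaleR_zero_left add_0_right by blast
  moreover have "\<forall>\<^sub>F t in at 0 within {0..}. 0 \<le> (t::real)"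
    by (auto simp: eventually_at_filter)
  ultimately show "\<forall>\<^sub>F t in at 0 within {0..}.
      0 \<le> (f (x + t *\<^sub>R v) - f (x + 0 *\<^sub>R v)) /\<^sub>R (t - 0)"
    by eventually_elim simp
  show "at (0::real) within {0..} \<noteq> bot"
    by (simp add: at_within_Ici_at_right)
qed

text \<open>The variational inequality for an arbitrary direction \<open>E\<close>. The data term is
  a quadratic polynomial in \<open>t\<close> along the ray, and the adjoint identity puts its slope
  in gradient form.\<close>

lemma local_minimum_J_variation:
  fixes \<gamma> \<alpha> :: real and A :: "real^'n^'m" and Y :: "real^'k^'m" and Z E :: "real^'k^'n"
  defines "W \<equiv> matrix_inv (\<gamma> *\<^sub>R mat 1 + (1 - \<gamma>) *\<^sub>R (transpose Z ** Z))"
  assumes \<gamma>: "0 \<le> \<gamma>" "\<gamma> \<le> 1" and \<alpha>: "0 < \<alpha>" and min: "local_minimum (J \<gamma> \<alpha> A Y) Z"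
    and inv: "0 < \<gamma> \<or> invertible (transpose Z ** Z)"
  shows "0 \<le> (\<Sum>i\<in>UNIV. if row i Z = 0 then weighted_norm W (row i E)
      else (row i E \<bullet> (W *v row i Z) -
        (1 - \<gamma>) * ((Z *v (W *v row i Z)) \<bullet> (E *v (W *v row i Z)))) / weighted_norm W (row i Z)) +
    1 / \<alpha> * ((transpose A ** (A ** Z - Y)) \<bullet> E)" (is "0 \<le> ?D + _ * (?G \<bullet> E)")
proof -
  let ?R = "A ** Z - Y"
  have "A ** (Z + t *\<^sub>R E) - Y = ?R + t *\<^sub>R (A ** E)" for t
    by (simp add: matrix_add_ldistrib matrix_scalar_ac scalar_matrix_assoc)
  then have norm2: "(norm (A ** (Z + t *\<^sub>R E) - Y))\<^sup>2 =
      ?R \<bullet> ?R + 2 * t * (?R \<bullet> (A ** E)) + t\<^sup>2 * ((A ** E) \<bullet> (A ** E))" for t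
    by (simp only: power2_norm_eq_inner)
      (simp add: inner_add_left inner_add_right inner_commute power2_eq_square algebra_simps)
  have "((\<lambda>t. 1 / (2 * \<alpha>) * (norm (A ** (Z + t *\<^sub>R E) - Y))\<^sup>2)
      has_real_derivative 1 / \<alpha> * (?R \<bullet> (A ** E))) (at 0 within {0..})"
    unfolding norm2 using \<alpha> by (auto intro!: derivative_eq_intros)
  then have "((\<lambda>t. J \<gamma> \<alpha> A Y (Z + t *\<^sub>R E)) has_real_derivative ?D + 1 / \<alpha> * (?R \<bullet> (A ** E)))
      (at 0 within {0..})"
    unfolding J_def W_def by (intro DERIV_add Psi_directional_derivative \<gamma> inv)
  then show ?thesis
    unfolding inner_matrix_mult
    by (rule local_minimum_directional_derivative_nonneg[OF min])
qed

section \<open>Optimality conditions\<close>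

text \<open>\<open>outer (axis n 1) v\<close> is the direction that changes only row
  \<open>n\<close>, by \<open>v\<close>. This and the next lemmas evaluate the variation
  there.\<close>

lemma row_outer_axis: "row i (outer (axis n 1) v) = (if i = n then v else 0)"
  by (simp add: row_def outer_def axis_def vec_eq_iff)

lemma outer_axis_mult_vector: "outer (axis n 1) v *v x = (v \<bullet> x) *\<^sub>R axis n 1"
  by (simp add: outer_def axis_def vec_eq_iff matrix_vector_mult_def inner_vec_def)

lemma vector_mult_outer: "x v* outer y z = (x \<bullet> y) *\<^sub>R z"
  by (simp add: outer_def vec_eq_iff vector_matrix_mult_def inner_vec_def sum_distrib_left mult_ac)

lemma inner_outer_axis: "G \<bullet> outer (axis n 1) v = row n G \<bullet> v"
proof -
  have "outer (axis n 1) v = axis n v"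
    by (simp add: outer_def axis_def vec_eq_iff)
  then show ?thesis
    by (simp add: inner_axis row_def vec_lambda_eta)
qed

lemma inner_mult_vector_axis: "(Z *v x) \<bullet> axis n 1 = row n Z \<bullet> x"
  for Z :: "real^'k^'n"
  by (simp add: inner_axis matrix_vector_mul_component row_def vec_lambda_eta)

theorem theorem5p4:
  fixes \<gamma> \<alpha> :: real
    and A :: "real^'n^'m" and Y :: "real^'k^'m" and Z :: "real^'k^'n"
    and W :: "real^'k^'k" and G :: "real^'k^'n"
  assumes "0 \<le> \<gamma>" and "\<gamma> \<le> 1" and "0 < \<alpha>"
    and "local_minimum (J \<gamma> \<alpha> A Y) Z"
    and "0 < \<gamma> \<or> invertible (transpose Z ** Z)"
  defines "W \<equiv> matrix_inv (\<gamma> *\<^sub>R mat 1 + (1 - \<gamma>) *\<^sub>R (transpose Z ** Z))"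
    and "G \<equiv> transpose A ** (A ** Z - Y)"
  shows "(\<forall>n. row n Z \<noteq> 0 \<longrightarrow>
            row n Z v* ((1 / weighted_norm W (row n Z)) *\<^sub>R W -
              (\<Sum>i\<in>UNIV. if row i Z = 0 then 0
                 else ((1 - \<gamma>) / weighted_norm W (row i Z)) *\<^sub>R
                        (W ** outer (row i Z) (row i Z) ** W)))
            + (1 / \<alpha>) *\<^sub>R row n G = 0) \<and>
         (\<forall>n. row n Z = 0 \<longrightarrow>
            weighted_norm W (row n G v* matrix_inv W) = weighted_norm (matrix_inv W) (row n G) \<and>
            weighted_norm (matrix_inv W) (row n G) \<le> \<alpha>)"
proof (intro conjI allI impI)
  let ?S = "\<gamma> *\<^sub>R mat 1 + (1 - \<gamma>) *\<^sub>R (transpose Z ** Z)"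
  have S: "sym_nonneg ?S" "invertible ?S"
    using sym_nonneg_regularized_Gram invertible_regularized_Gram assms(1,2,5) by blast+
  have invW: "matrix_inv W = ?S"
    by (simp add: W_def matrix_inv_matrix_inv S)
  have symW: "transpose W = W"
    using sym_nonneg_matrix_inv[OF S] by (simp add: W_def sym_nonneg_def)
  then have vW: "z v* W = W *v z" for z
    by (metis transpose_matrix_vector)
  \<comment> \<open>With \<open>E = outer (axis n 1) v\<close>, the product \<open>E *v u\<close> is
    \<open>(v \<bullet> u) *\<^sub>R axis n 1\<close>, so its inner product with
    \<open>Z *v u\<close> picks out row \<open>n\<close> of \<open>Z\<close>.\<close>
  have variation: "0 \<le> (\<Sum>i\<in>UNIV. if row i Z = 0 then weighted_norm W (if i = n then v else 0)
      else ((if i = n then v else 0) \<bullet> (W *v row i Z) -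
        (1 - \<gamma>) * ((row n Z \<bullet> (W *v row i Z)) * (v \<bullet> (W *v row i Z)))) / weighted_norm W (row i Z)) +
    1 / \<alpha> * (row n G \<bullet> v)" for n v
    using local_minimum_J_variation[OF assms(1-5), of "outer (axis n 1) v"]
    unfolding row_outer_axis outer_axis_mult_vector inner_scaleR_right inner_mult_vector_axis
      inner_outer_axis W_def[symmetric] G_def[symmetric] by (simp only: mult.commute)
  {
    fix n assume n: "row n Z \<noteq> 0"
    let ?c = "\<lambda>i. 1 / weighted_norm W (row i Z)"
    \<comment> \<open>\<open>h\<close> is row \<open>n\<close> of the gradient of
      \<open>Psi\<close>: the derivative in direction \<open>v\<close> turns out to be
      \<open>v \<bullet> h\<close>.\<close>
    define h where "h = ?c n *\<^sub>R (W *v row n Z) - (\<Sum>i\<in>UNIV. if row i Z = 0 then 0 else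
      ((1 - \<gamma>) * ?c i * (row n Z \<bullet> (W *v row i Z))) *\<^sub>R (W *v row i Z))"
    have "row n Z v* (W ** outer (row i Z) (row i Z) ** W) =
        (row n Z \<bullet> (W *v row i Z)) *\<^sub>R (W *v row i Z)" for i
      by (simp add: vector_matrix_mul_assoc[symmetric] vector_mult_outer scaleR_vector_matrix_assoc
          vW matrix_vector_mult_scaleR symmetric_inner_matrix[OF symW])
    then have h: "row n Z v* (?c n *\<^sub>R W - (\<Sum>i\<in>UNIV. if row i Z = 0 then 0
        else ((1 - \<gamma>) / weighted_norm W (row i Z)) *\<^sub>R
          (W ** outer (row i Z) (row i Z) ** W))) = h"
      unfolding h_def vector_matrix_mult_diff_rdistrib
        bounded_bilinear.sum_right[OF bounded_bilinear_vector_matrix_mult]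
      by (intro arg_cong2[of _ _ _ _ minus] sum.cong)
        (simp_all add: vector_scaleR_matrix_ac vW)
    have "0 \<le> v \<bullet> h + 1 / \<alpha> * (row n G \<bullet> v)" for v
    proof -
      \<comment> \<open>Every zero row has an index other than \<open>n\<close>, so its increment is
        zero and it contributes nothing.\<close>
      have "(\<Sum>i\<in>UNIV. if row i Z = 0 then weighted_norm W (if i = n then v else 0)
        else ((if i = n then v else 0) \<bullet> (W *v row i Z) -
          (1 - \<gamma>) * ((row n Z \<bullet> (W *v row i Z)) * (v \<bullet> (W *v row i Z)))) / weighted_norm W (row i Z))
        = (\<Sum>i\<in>UNIV. (if i = n then ?c n * (v \<bullet> (W *v row n Z)) else 0) - (if row i Z = 0 then 0 else
          (1 - \<gamma>) * ?c i * (row n Z \<bullet> (W *v row i Z)) * (v \<bullet> (W *v row i Z))))"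
        using n by (intro sum.cong refl) (auto simp: weighted_norm_eq diff_divide_distrib add_divide_distrib
            algebra_simps)
      also have "\<dots> = v \<bullet> h"
        by (simp add: h_def sum_subtractf inner_diff_right inner_sum_right
            if_distrib[of "inner v"] cong: if_cong)
      finally show ?thesis
        using variation[of n v] by simp
    qed
    \<comment> \<open>The right-hand side is linear in \<open>v\<close>; the negative gradient as
      \<open>v\<close> gives minus its squared norm.\<close>
    from this[of "- (h + (1 / \<alpha>) *\<^sub>R row n G)"]
    have "(h + (1 / \<alpha>) *\<^sub>R row n G) \<bullet> (h + (1 / \<alpha>) *\<^sub>R row n G) \<le> 0"
      by (simp add: inner_add_left inner_add_right inner_commute algebra_simps)
    then show "row n Z v* ((1 / weighted_norm W (row n Z)) *\<^sub>R W -
              (\<Sum>i\<in>UNIV. if row i Z = 0 then 0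
                 else ((1 - \<gamma>) / weighted_norm W (row i Z)) *\<^sub>R
                        (W ** outer (row i Z) (row i Z) ** W)))
            + (1 / \<alpha>) *\<^sub>R row n G = 0"
      unfolding h by (metis inner_gt_zero_iff not_le)
  next
    fix n assume n: "row n Z = 0"
    let ?g = "row n G" and ?T = "matrix_inv W"
    have gT: "?g v* ?T = ?T *v ?g"
      using S unfolding invW sym_nonneg_def by (metis transpose_matrix_vector)
    have "W *v (?T *v ?g) = ?g"
      unfolding invW by (simp add: W_def matrix_vector_mul_assoc matrix_inv_left S)
    then show eq: "weighted_norm W (?g v* ?T) = weighted_norm ?T ?g"
      unfolding gT weighted_norm_eq by (simp add: inner_commute)
    have neg: "weighted_norm W (- v) = weighted_norm W v" for v
      by (simp add: weighted_norm_eq bounded_bilinear.minus_right[OF bounded_bilinear_matrix_vector_mult])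
    \<comment> \<open>Since \<open>row n Z = 0\<close>, the coupling through \<open>W\<close>
      vanishes, and nonzero rows have zero increment; only the norm of \<open>v\<close>
      remains.\<close>
    have "(\<Sum>i\<in>UNIV. if row i Z = 0 then weighted_norm W (if i = n then v else 0)
        else ((if i = n then v else 0) \<bullet> (W *v row i Z) -
          (1 - \<gamma>) * ((row n Z \<bullet> (W *v row i Z)) * (v \<bullet> (W *v row i Z)))) / weighted_norm W (row i Z))
        = (\<Sum>i\<in>UNIV. if i = n then weighted_norm W v else 0)" for v
      using n by (intro sum.cong refl) (auto simp: weighted_norm_eq)
    then have "0 \<le> weighted_norm W v + 1 / \<alpha> * (?g \<bullet> v)" for v
      using variation[of n v] by simp
    \<comment> \<open>For this \<open>v\<close> the inner product is minus the squared
      \<open>?T\<close>-weighted norm of \<open>?g\<close>, while by \<open>eq\<close> the norm of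
      \<open>v\<close> is that norm itself.\<close>
    from this[of "- (?g v* ?T)"] have "?g \<bullet> (?T *v ?g) \<le> \<alpha> * weighted_norm ?T ?g"
      using assms(3) by (simp add: neg eq) (simp add: gT field_simps)
    moreover have nn: "0 \<le> ?g \<bullet> (?T *v ?g)"
      using S(1) by (simp add: invW sym_nonneg_def)
    then have "?g \<bullet> (?T *v ?g) = weighted_norm ?T ?g * weighted_norm ?T ?g"
      by (simp add: weighted_norm_eq)
    ultimately have "weighted_norm ?T ?g * weighted_norm ?T ?g \<le> \<alpha> * weighted_norm ?T ?g"
      by simp
    moreover have "0 \<le> weighted_norm ?T ?g"
      using nn by (simp add: weighted_norm_eq)
    \<comment> \<open>Divide by the norm; if it is zero, the bound is just \<alpha> > 0.\<close>
    ultimately show "weighted_norm ?T ?g \<le> \<alpha>"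
      using assms(3) by (cases "weighted_norm ?T ?g = 0") (auto simp: mult_le_cancel_right)
  }
qed

end
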